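(* Let $D_1,D_2,\ldots,D_k$ be a collection of $k\ge 2$ pairwise vertex disjoint digraphs with Hamiltonian cycles $C_1,C_2,\ldots,C_k$, respectively, and let $D\in\oplus_{i=1}^k D_i$. If $D$ is strong and contains no good cycle, then $D$ is vertex-pancyclic.
   Context: All paths and cycles are directed. Generalized sum: for pairwise vertex disjoint digraphs $D_1,\ldots,D_k$, $\oplus_{i=1}^k D_i$ is the set of all digraphs $D$ with $V(D)=\bigcup_i V(D_i)$, such that the subdigraph of $D$ induced by $V(D_i)$ is $D_i$ for each $i$, and such that between each pair of vertices lying in different $D_i$'s there is exactly one arc (in one direction). The arcs of $D$ joining vertices of different summands are called exterior arcs; their set is $E_\oplus$. A digraph is strong if for any two distinct vertices $u,v$ there are a directed $uv$-path and a directed $vu$-path. A digraph $D$ of order $N\ge 3$ is vertex-pancyclic if for every vertex $v$ and every $\ell\in\{3,\ldots,N\}$, $D$ contains a directed cycle of length $\ell$ through $v$. An anti-directed 4-cycle is a sequence $v_0v_1v_2v_3v_0$ of four distinct vertices with arcs $(v_0,v_1),(v_0,v_3),(v_2,v_1),(v_2,v_3)\in A(D)$. A good cycle is an anti-directed 4-cycle $v_0v_1v_2v_3v_0$ such that $\{(v_0,v_1),(v_2,v_3)\}\subseteq E_\oplus$ or $\{(v_2,v_1),(v_0,v_3)\}\subseteq E_\oplus$. *)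

theory Defs
  imports
    "Graph_Theory.Digraph_Component"
    "HOL-Library.Disjoint_Sets"
begin

text \<open>
  Digraphs are finite, without loops and without parallel arcs; arcs are ordered pairs of
  vertices (locale \<open>pair_digraph\<close>). Opposite arcs \<open>(u, v)\<close> and \<open>(v, u)\<close> may both be
  present. In a loopfree digraph, \<open>pre_digraph.cycle\<close> describes exactly the directed cycles
  of length at least 2, given as lists of arcs; the tails of these arcs are the vertices of
  the cycle.
\<close>

definition hamiltonian_cycle :: "'a pair_pre_digraph \<Rightarrow> ('a \<times> 'a) awalk \<Rightarrow> bool" where
  "hamiltonian_cycle G p \<longleftrightarrow>
     pre_digraph.cycle (with_proj G) p \<and> fst ` set p = pverts G"

text \<open>
  The summands are intended to be pairwise vertex disjoint. Between vertices of different
  summands exactly one of the two possible arcs is present.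
\<close>

definition generalized_sum ::
    "'i set \<Rightarrow> ('i \<Rightarrow> 'a pair_pre_digraph) \<Rightarrow> 'a pair_pre_digraph set" where
  "generalized_sum I Ds =
     {D. pair_digraph D \<and>
         pverts D = (\<Union>i\<in>I. pverts (Ds i)) \<and>
         (\<forall>i\<in>I. induced_subgraph (with_proj (Ds i)) (with_proj D)) \<and>
         (\<forall>i\<in>I. \<forall>j\<in>I. i \<noteq> j \<longrightarrow>
            (\<forall>u\<in>pverts (Ds i). \<forall>v\<in>pverts (Ds j).
               ((u, v) \<in> parcs D) \<noteq> ((v, u) \<in> parcs D)))}"

definition exterior_arcs ::
    "'i set \<Rightarrow> ('i \<Rightarrow> 'a pair_pre_digraph) \<Rightarrow> 'a pair_pre_digraph \<Rightarrow> ('a \<times> 'a) set" where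
  "exterior_arcs I Ds D =
     {(u, v) \<in> parcs D. \<exists>i\<in>I. \<exists>j\<in>I. i \<noteq> j \<and> u \<in> pverts (Ds i) \<and> v \<in> pverts (Ds j)}"

definition antidirected_4_cycle ::
    "'a pair_pre_digraph \<Rightarrow> 'a \<Rightarrow> 'a \<Rightarrow> 'a \<Rightarrow> 'a \<Rightarrow> bool" where
  "antidirected_4_cycle D v0 v1 v2 v3 \<longleftrightarrow>
     distinct [v0, v1, v2, v3] \<and>
     {(v0, v1), (v0, v3), (v2, v1), (v2, v3)} \<subseteq> parcs D"

definition good_cycle ::
    "'i set \<Rightarrow> ('i \<Rightarrow> 'a pair_pre_digraph) \<Rightarrow> 'a pair_pre_digraph \<Rightarrow>
      'a \<Rightarrow> 'a \<Rightarrow> 'a \<Rightarrow> 'a \<Rightarrow> bool" where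
  "good_cycle I Ds D v0 v1 v2 v3 \<longleftrightarrow>
     antidirected_4_cycle D v0 v1 v2 v3 \<and>
     ({(v0, v1), (v2, v3)} \<subseteq> exterior_arcs I Ds D \<or>
      {(v2, v1), (v0, v3)} \<subseteq> exterior_arcs I Ds D)"

definition vertex_pancyclic :: "'a pair_pre_digraph \<Rightarrow> bool" where
  "vertex_pancyclic G \<longleftrightarrow>
     card (pverts G) \<ge> 3 \<and>
     (\<forall>v\<in>pverts G. \<forall>l\<in>{3..card (pverts G)}.
        \<exists>p. pre_digraph.cycle (with_proj G) p \<and> length p = l \<and> v \<in> fst ` set p)"

end

theory Submission
  imports Defs
begin

text \<open>
  Traverse two of the Hamiltonian cycles as \<open>x\<^sub>s\<close> and \<open>y\<^sub>r\<close>, indexed by the integers. Without good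
  cycles an arc \<open>x\<^sub>s \<rightarrow> y\<^sub>r\<close> forces \<open>x\<^sub>s\<^sub>+\<^sub>1 \<rightarrow> y\<^sub>r\<^sub>-\<^sub>1\<close>, so the direction of the arc between \<open>x\<^sub>s\<close> and
  \<open>y\<^sub>r\<close> depends only on \<open>s + r\<close>. Both directions occur, since otherwise two vertices of each
  summand form a good cycle of exterior arcs.

  A third summand is impossible: some path \<open>y\<^sub>e \<rightarrow> z \<rightarrow> y\<^sub>e\<^sub>+\<^sub>1\<close> exists, and pulling an arc from
  \<open>x\<close> back along it shifts \<open>x\<close> by two but \<open>y\<close> only by one, so all arcs between the
  first two summands would have the same direction.

  For two summands, a path of \<open>b\<close> arcs along \<open>x\<close> and one of \<open>a\<close> arcs along \<open>y\<close> can be joined to a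
  cycle of length \<open>a + b + 2\<close> unless \<open>a - b\<close> is a period of the direction. If this fails for all
  admissible \<open>a\<close> and \<open>b\<close> of a given sum, either the cycle sought is Hamiltonian or the direction
  alternates; in both cases a cycle alternating twice between \<open>x\<close> and \<open>y\<close> does it.
\<close>

section \<open>Hamiltonian cycles as periodic integer-indexed sequences\<close>

lemma pawalk_verts_conv_fst: "pcas u p v \<Longrightarrow> pawalk_verts u p = map fst p @ [v]"
  by (induction p arbitrary: u) auto

lemma pawalk_verts_conv_snd: "pcas u p v \<Longrightarrow> pawalk_verts u p = u # map snd p"
  by (induction p arbitrary: u) auto

text \<open>Indices are arbitrary integers read modulo \<open>n\<close>, so shifts in either
  direction need no wrap-around cases.\<close>

definition cyclic_parametrization :: "'a pair_pre_digraph \<Rightarrow> (int \<Rightarrow> 'a) \<Rightarrow> int \<Rightarrow> bool" where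
  "cyclic_parametrization G x n \<longleftrightarrow>
     n \<ge> 2 \<and> n = int (card (pverts G)) \<and> range x = pverts G \<and>
     (\<forall>s t. x s = x t \<longleftrightarrow> s mod n = t mod n) \<and> (\<forall>s. (x s, x (s + 1)) \<in> parcs G)"

lemma hamiltonian_cycle_imp_parametrization:
  assumes G: "pair_digraph G" and ham: "hamiltonian_cycle G p"
  shows "\<exists>x n. cyclic_parametrization G x n"
proof -
  interpret pair_digraph G by fact
  obtain u where arcs: "set p \<subseteq> parcs G" and cas: "pcas u p u" and ne: "p \<noteq> []"
    and dist: "distinct (tl (pawalk_verts u p))"
    using ham unfolding hamiltonian_cycle_def pre_digraph.cycle_def pre_digraph.awalk_def by auto
  have range: "fst ` set p = pverts G"
    using ham by (simp add: hamiltonian_cycle_def)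
  have shift: "map fst p @ [u] = u # map snd p"
    using pawalk_verts_conv_fst[OF cas] pawalk_verts_conv_snd[OF cas] by simp
  \<comment> \<open>\<open>cycle\<close> makes only the heads of the arcs distinct. Both sides list
    the vertices of the closed walk, so cancelling \<open>u\<close> shows that the tails are a
    permutation of the heads.\<close>
  have "mset (map fst p @ [u]) = mset (u # map snd p)"
    using shift by (rule arg_cong)
  then have "mset (map fst p) = mset (map snd p)" by simp
  moreover have "distinct (map snd p)"
    using dist pawalk_verts_conv_snd[OF cas] by simp
  ultimately have dist_fst: "distinct (map fst p)"
    using mset_eq_imp_distinct_iff by blast
  define n where "n = int (length p)"
  define x where "x s = fst (p ! nat (s mod n))" for s
  have n_pos: "n > 0" using ne by (simp add: n_def)
  have idx: "nat (s mod n) < length p" for s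
    using n_pos by (simp add: n_def nat_less_iff)
  have snd_eq: "snd (p ! i) = fst (p ! (Suc i mod length p))" if "i < length p" for i
  proof -
    have "snd (p ! i) = (map fst p @ [u]) ! Suc i"
      using that by (simp add: shift)
    also have "\<dots> = fst (p ! (Suc i mod length p))"
    proof (cases "Suc i = length p")
      case True
      have "fst (p ! 0) = (map fst p @ [u]) ! 0" using ne by (simp add: nth_append)
      then have "fst (p ! 0) = u" by (simp add: shift)
      then show ?thesis using True by (simp add: nth_append)
    next
      case False
      then show ?thesis using that by (simp add: nth_append)
    qed
    finally show ?thesis .
  qed
  have step: "p ! nat (s mod n) = (x s, x (s + 1))" for s
  proof -
    have "int (Suc (nat (s mod n)) mod length p) = (s + 1) mod n"
      using n_pos by (simp add: n_def zmod_int mod_simps add.commute)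
    then have "Suc (nat (s mod n)) mod length p = nat ((s + 1) mod n)"
      by (metis nat_int)
    then show ?thesis
      using snd_eq[OF idx, of s] by (simp add: x_def prod_eq_iff)
  qed
  have arc: "(x s, x (s + 1)) \<in> parcs G" for s
    using arcs nth_mem[OF idx, of s] by (auto simp: step)
  have eq: "x s = x t \<longleftrightarrow> s mod n = t mod n" for s t
    using nth_eq_iff_index_eq[OF dist_fst, of "nat (s mod n)" "nat (t mod n)"] idx[of s] idx[of t]
      n_pos by (auto simp: x_def eq_nat_nat_iff)
  have "n \<noteq> 1"
  proof
    assume "n = 1"
    then have "x 0 = x 1" by (simp add: eq)
    then show False using arc[of 0] no_loops'[of "x 0" "x 1"] by auto
  qed
  moreover have "range x = pverts G"
  proof -
    have "range x = (\<lambda>i. fst (p ! i)) ` {..<length p}"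
    proof (rule set_eqI, rule iffI)
      fix v assume "v \<in> (\<lambda>i. fst (p ! i)) ` {..<length p}"
      then obtain i where "i < length p" "v = fst (p ! i)" by auto
      then have "v = x (int i)" by (simp add: x_def n_def)
      then show "v \<in> range x" by simp
    qed (auto simp: x_def idx)
    then show ?thesis using range by (force simp: in_set_conv_nth image_iff)
  qed
  moreover have "n = int (card (pverts G))"
    using distinct_card[OF dist_fst] range by (simp add: n_def)
  ultimately show ?thesis
    unfolding cyclic_parametrization_def using n_pos eq arc
    by (intro exI[of _ x] exI[of _ n]) simp
qed

section \<open>Cycles given by their vertex lists\<close>

lemma pcas_zip_tl:
  "vs \<noteq> [] \<Longrightarrow> pcas (hd vs) (zip vs (tl vs @ [w])) w"
proof (induction vs)
  case (Cons v vs)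
  then show ?case by (cases vs) auto
qed simp

lemma set_zip_tl_subset:
  "vs \<noteq> [] \<Longrightarrow> successively (\<lambda>u v. (u, v) \<in> E) vs \<Longrightarrow> (last vs, w) \<in> E
    \<Longrightarrow> set (zip vs (tl vs @ [w])) \<subseteq> E"
proof (induction vs)
  case (Cons v vs)
  then show ?case by (cases vs) auto
qed simp

definition closed_path :: "('a \<times> 'a) set \<Rightarrow> 'a list \<Rightarrow> bool" where
  "closed_path E vs \<longleftrightarrow>
     vs \<noteq> [] \<and> distinct vs \<and> successively (\<lambda>u v. (u, v) \<in> E) vs \<and> (last vs, hd vs) \<in> E"

lemma closed_path_imp_cycle:
  assumes G: "pair_digraph G" and vs: "closed_path (parcs G) vs"
  shows "\<exists>p. pre_digraph.cycle (with_proj G) p \<and> length p = length vs \<and> fst ` set p = set vs"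
proof -
  interpret pair_digraph G by fact
  let ?p = "zip vs (tl vs @ [hd vs])"
  have ne: "vs \<noteq> []" and dist: "distinct vs"
    using vs by (auto simp: closed_path_def)
  have cas: "pcas (hd vs) ?p (hd vs)" by (rule pcas_zip_tl[OF ne])
  have sub: "set ?p \<subseteq> parcs G"
    using vs by (intro set_zip_tl_subset) (auto simp: closed_path_def)
  have len: "length (tl vs @ [hd vs]) = length vs" using ne by simp
  have "map snd ?p = tl vs @ [hd vs]" using len by (simp add: map_snd_zip)
  moreover have "distinct (tl vs @ [hd vs])" using ne dist by (cases vs) auto
  ultimately have "distinct (tl (pawalk_verts (hd vs) ?p))"
    using pawalk_verts_conv_snd[OF cas] by simp
  moreover have ne_p: "?p \<noteq> []" using ne by (cases vs) auto
  moreover have "hd vs \<in> pverts G"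
  proof -
    have "(last vs, hd vs) \<in> parcs G" using vs by (simp add: closed_path_def)
    then show ?thesis using in_arcsD2 by blast
  qed
  ultimately have "pre_digraph.cycle (with_proj G) ?p"
    unfolding pre_digraph.cycle_def pre_digraph.awalk_def using cas sub
    by (intro exI[of _ "hd vs"]) simp
  moreover have "length ?p = length vs" using len by simp
  moreover have "fst ` set ?p = set vs"
    using len map_fst_zip[of vs "tl vs @ [hd vs]"] by (metis list.set_map)
  ultimately show ?thesis by blast
qed

section \<open>Segments of a periodic sequence\<close>

lemma distinct_map_cyclic:
  fixes x :: "int \<Rightarrow> 'a"
  assumes "\<And>s t. x s = x t \<longleftrightarrow> s mod n = t mod n" "b - a < n"
  shows "distinct (map x [a..b])"
proof -
  have "s = t" if "s \<in> {a..b}" "t \<in> {a..b}" "s mod n = t mod n" for s t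
  proof -
    have "n dvd s - t" using that(3) by (simp add: mod_eq_dvd_iff)
    moreover have "\<bar>s - t\<bar> < n" using that assms(2) by auto
    ultimately show ?thesis using zdvd_imp_le[of n "\<bar>s - t\<bar>"] by fastforce
  qed
  then show ?thesis by (auto simp: distinct_map inj_on_def assms(1))
qed

lemma successively_map_upto:
  assumes "\<And>s. R (x s) (x (s + 1 :: int))"
  shows "successively R (map x [a..b])"
proof (induction a b rule: upto.induct)
  case (1 i j)
  show ?case
  proof (cases "i < j")
    case True
    then have "[i..j] = i # [i + 1..j]" "[i + 1..j] = (i + 1) # [i + 1 + 1..j]"
      by (simp_all only: upto_rec1)
    then show ?thesis using 1 True assms by simp
  next
    case False
    then show ?thesis by (cases "i = j") auto
  qed
qed

lemma hd_last_map_upto: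
  assumes "a \<le> (b::int)"
  shows "hd (map x [a..b]) = x a" "last (map x [a..b]) = x b"
proof -
  show "hd (map x [a..b]) = x a" using assms by (simp add: upto_rec1)
  show "last (map x [a..b]) = x b" using assms by (simp add: upto_rec2)
qed

section \<open>Directions of the arcs between two cycles\<close>

locale linked_cycles =
  fixes E :: "('a \<times> 'a) set" and x y :: "int \<Rightarrow> 'a" and n m :: int
  assumes n: "n \<ge> 2" and m: "m \<ge> 2"
    and x_eq: "x s = x t \<longleftrightarrow> s mod n = t mod n"
    and y_eq: "y s = y t \<longleftrightarrow> s mod m = t mod m"
    and x_neq_y: "x s \<noteq> y r"
    and x_arc: "(x s, x (s + 1)) \<in> E"
    and y_arc: "(y r, y (r + 1)) \<in> E"
    and one_arc: "(x s, y r) \<in> E \<longleftrightarrow> (y r, x s) \<notin> E"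
    and shift: "(x s, y r) \<in> E \<Longrightarrow> (x (s + 1), y (r - 1)) \<in> E"
    and both_ways: "\<exists>s r. (x s, y r) \<in> E" "\<exists>s r. (x s, y r) \<notin> E"
begin

text \<open>By \<open>one_arc\<close>, the contrapositive of \<open>shift\<close> is
  \<open>shift\<close> with the two cycles exchanged. Results about vertices of \<open>x\<close>
  thus carry over to vertices of \<open>y\<close>.\<close>

lemma flip: "linked_cycles E y x m n"
proof unfold_locales
  show "(y s, x r) \<in> E \<Longrightarrow> (y (s + 1), x (r - 1)) \<in> E" for s r
    using one_arc[of r s] one_arc[of "r - 1" "s + 1"] shift[of "r - 1" "s + 1"] by auto
  show "\<exists>s r. (y s, x r) \<in> E" "\<exists>s r. (y s, x r) \<notin> E"
    using both_ways one_arc by blast+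
  show "y s \<noteq> x r" for s r using x_neq_y[of r s] by simp
  show "((y s, x r) \<in> E) = ((x r, y s) \<notin> E)" for s r using one_arc[of r s] by simp
qed (use n m x_eq y_eq x_arc y_arc in auto)

text \<open>The common direction of all arcs with index sum \<open>c\<close>, read off at
  \<open>r = 0\<close>.\<close>

definition P :: "int \<Rightarrow> bool" where "P c \<longleftrightarrow> (x c, y 0) \<in> E"

lemma shift_iter: "(x s, y r) \<in> E \<Longrightarrow> (x (s + int t), y (r - int t)) \<in> E"
proof (induction t)
  case (Suc t)
  then show ?case using shift[of "s + int t" "r - int t"] by (simp add: algebra_simps)
qed simp

text \<open>Shifting \<open>n * m\<close> times returns to the original pair of vertices, so
  \<open>n * m - 1\<close> further shifts undo one.\<close>

lemma shift_iff: "(x s, y r) \<in> E \<longleftrightarrow> (x (s + 1), y (r - 1)) \<in> E"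
proof
  assume "(x (s + 1), y (r - 1)) \<in> E"
  moreover have "n * m \<ge> 1" using n m by (smt (verit) mult_pos_pos)
  ultimately have "(x (s + n * m), y (r - n * m)) \<in> E"
    using shift_iter[of "s + 1" "r - 1" "nat (n * m - 1)"] by simp
  moreover have "x (s + n * m) = x s" "y (r - n * m) = y r"
    by (simp_all add: x_eq y_eq mod_eq_dvd_iff)
  ultimately show "(x s, y r) \<in> E" by simp
qed (rule shift)

lemma E_iff_P: "(x s, y r) \<in> E \<longleftrightarrow> P (s + r)"
proof -
  have "(x (s + int t), y (r - int t)) \<in> E \<longleftrightarrow> (x s, y r) \<in> E" for s r t
  proof (induction t)
    case (Suc t)
    then show ?case using shift_iff[of "s + int t" "r - int t"] by (simp add: algebra_simps)
  qed simp
  from this[of s "nat r" r] this[of "s + r" "nat (- r)" 0] show ?thesis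
    by (cases "r \<ge> 0") (auto simp: P_def)
qed

lemma E_back_iff_P: "(y r, x s) \<in> E \<longleftrightarrow> \<not> P (s + r)"
  using E_iff_P one_arc by blast

lemma P_cong_n: "c mod n = d mod n \<Longrightarrow> P c \<longleftrightarrow> P d"
  unfolding P_def using x_eq by metis

lemma P_add_m: "P (c + m) \<longleftrightarrow> P c"
  using E_iff_P[of c m] E_iff_P[of c 0] y_eq[of m 0] by simp

lemma P_ex: "\<exists>c. P c" "\<exists>c. \<not> P c"
  using both_ways E_iff_P by blast+

text \<open>Adding \<open>d\<close> another \<open>n - 1\<close> times leads from
  \<open>c + d\<close> to \<open>c + n * d\<close>, which has the same residue as \<open>c\<close>
  modulo \<open>n\<close>.\<close>

lemma closed_shift_iff:
  assumes closed: "\<And>c. P c \<Longrightarrow> P (c + d)"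
  shows "P (c + d) \<longleftrightarrow> P c"
proof
  have iter: "P (c + int t * d)" if "P c" for c t
  proof (induction t)
    case (Suc t)
    then show ?case using closed[of "c + int t * d"] by (simp add: algebra_simps)
  qed (use that in simp)
  assume "P (c + d)"
  from iter[OF this, of "nat (n - 1)"] have "P (c + n * d)"
    using n by (simp add: algebra_simps)
  then show "P c" using P_cong_n[of "c + n * d" c] by simp
qed (rule closed)

text \<open>Otherwise \<open>P\<close> would be constant. This supplies every place where the
  direction changes.\<close>

lemma not_closed_succ: "\<not> (\<forall>c. P c \<longrightarrow> P (c + 1))"
proof
  assume "\<forall>c. P c \<longrightarrow> P (c + 1)"
  then have succ: "P (c + 1) \<longleftrightarrow> P c" for c by (intro closed_shift_iff) auto
  have "P c \<longleftrightarrow> P 0" for c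
  proof (induction c rule: int_induct[of _ 0])
    case (step2 i)
    then show ?case using succ[of "i - 1"] by simp
  qed (auto simp: succ)
  then show False using P_ex by blast
qed

section \<open>Cycles of prescribed length through a given vertex\<close>

lemma closed_path_single_crossing:
  assumes "0 \<le> a" "a < m" "0 \<le> b" "b < n" "P c" "\<not> P (c + a - b)"
  shows "\<exists>vs. closed_path E vs \<and> int (length vs) = a + b + 2 \<and> x s \<in> set vs"
proof (intro exI conjI)
  \<comment> \<open>The arc from \<open>x\<close> to \<open>y\<close> then has index sum
    \<open>c\<close>, and the returning arc from \<open>y (r + a)\<close> to
    \<open>x (s - b)\<close> has index sum \<open>c + a - b\<close>.\<close>
  define r where "r = c - s"
  let ?vs = "map x [s - b..s] @ map y [r..r + a]"
  note ends = hd_last_map_upto[of "s - b" s x] hd_last_map_upto[of r "r + a" y]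
  have "(x s, y r) \<in> E" "(y (r + a), x (s - b)) \<in> E"
    using assms by (simp_all add: E_iff_P E_back_iff_P r_def algebra_simps)
  moreover have "distinct ?vs"
    using distinct_map_cyclic[of x n s "s - b"] distinct_map_cyclic[of y m "r + a" r]
      x_eq y_eq x_neq_y assms by (auto simp del: distinct_map simp: distinct_append)
  ultimately show "closed_path E ?vs"
    using ends assms successively_map_upto[of "\<lambda>u v. (u, v) \<in> E" x] x_arc
      successively_map_upto[of "\<lambda>u v. (u, v) \<in> E" y] y_arc
    by (auto simp: closed_path_def successively_append_iff simp del: successively_map distinct_map)
  show "int (length ?vs) = a + b + 2" using assms by simp
  show "x s \<in> set ?vs" using assms by simp
qed

text \<open>Insert the single vertex \<open>y u\<close> between \<open>x (q - 1)\<close> and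
  \<open>x q\<close> in a segment of \<open>i\<close> vertices of \<open>x\<close>, then return to
  \<open>x s\<close> along the next \<open>j - 1\<close> vertices of \<open>y\<close>. The four
  conditions on \<open>P\<close> are the index sums of the four crossing arcs.\<close>

lemma closed_path_double_crossing:
  assumes "s < q" "q < s + i" "i \<le> n" "2 \<le> j" "j \<le> m"
    and "P (q - 1 + u)" "\<not> P (q + u)" "P (s + i + u)" "\<not> P (s + u + j - 1)"
  shows "\<exists>vs. closed_path E vs \<and> int (length vs) = i + j \<and> x s \<in> set vs"
proof (intro exI conjI)
  let ?R = "\<lambda>u v. (u, v) \<in> E"
  let ?vs = "(map x [s..q - 1] @ [y u]) @ (map x [q..s + i - 1] @ map y [u + 1..u + j - 1])"
  note ends = hd_last_map_upto[of s "q - 1" x] hd_last_map_upto[of q "s + i - 1" x]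
    hd_last_map_upto[of "u + 1" "u + j - 1" y]
  have "(x (q - 1), y u) \<in> E" "(y u, x q) \<in> E" "(x (s + i - 1), y (u + 1)) \<in> E"
    "(y (u + j - 1), x s) \<in> E"
    using assms by (simp_all add: E_iff_P E_back_iff_P algebra_simps)
  moreover have "distinct ?vs"
  proof -
    have "distinct (map x [s..s + i - 1])" "distinct (map y [u..u + j - 1])"
      by (rule distinct_map_cyclic[of x n] distinct_map_cyclic[of y m], rule x_eq y_eq,
          use assms in simp)+
    moreover have "[s..s + i - 1] = [s..q - 1] @ [q..s + i - 1]"
      using assms by (intro upto_split1) auto
    moreover have "[u..u + j - 1] = u # [u + 1..u + j - 1]"
      using assms by (simp add: upto_rec1)
    ultimately show ?thesis using x_neq_y
      by (auto simp del: distinct_map simp: distinct_append; metis)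
  qed
  moreover have "successively ?R (map x [s..q - 1])" "successively ?R (map x [q..s + i - 1])"
    "successively ?R (map y [u + 1..u + j - 1])"
    by (rule successively_map_upto, rule x_arc y_arc)+
  ultimately show "closed_path E ?vs"
    using ends assms
    by (auto simp: closed_path_def successively_append_iff successively_Cons
        simp del: successively_map distinct_map)
  show "int (length ?vs) = i + j" using assms by simp
  show "x s \<in> set ?vs" using assms by simp
qed

lemma hamiltonian_closed_path:
  "\<exists>vs. closed_path E vs \<and> int (length vs) = n + m \<and> x s \<in> set vs"
proof -
  obtain d where d: "\<not> P (d - 1)" "P d"
  proof -
    obtain c where c: "P c" "\<not> P (c + 1)" using not_closed_succ by blast
    have "\<exists>d. \<not> P (d - 1) \<and> P d"
    \<comment> \<open>Without a change from false to true, \<open>P\<close> would stay false from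
      \<open>c + 1\<close> up to \<open>c + n\<close>, but \<open>c + n\<close> is congruent to
      \<open>c\<close>.\<close>
    proof (rule ccontr)
      assume *: "\<not> ?thesis"
      have "P (c + 1 + int t) \<longrightarrow> False" for t
      proof (induction t)
        case (Suc t)
        then show ?case using * c by (metis add_diff_cancel_right' int_Suc add.assoc)
      qed (use c in simp)
      from this[of "nat (n - 1)"] have "\<not> P (c + n)" using n by simp
      then show False using c P_cong_n[of "c + n" c] by simp
    qed
    then show thesis using that by blast
  qed
  \<comment> \<open>The detour through one vertex of \<open>y\<close> needs a change from true to
    false; \<open>d + t\<close> is the first one after \<open>d\<close>. It comes at the latest at
    \<open>d + n - 1\<close>, as \<open>P\<close> is false at \<open>d - 1\<close>, so the detour
    lies within one turn of \<open>x\<close>.\<close>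
  define t where "t = (LEAST t. \<not> P (d + int t))"
  have ex: "\<not> P (d + int (nat (n - 1)))"
    using d n P_cong_n[of "d - 1 + n" "d - 1"]
    by (simp add: mod_add_self2) (simp add: algebra_simps)
  have t: "\<not> P (d + int t)" unfolding t_def by (rule LeastI[where P = "\<lambda>t. \<not> P (d + int t)", OF ex])
  have t_le: "t \<le> nat (n - 1)" unfolding t_def by (rule Least_le[where P = "\<lambda>t. \<not> P (d + int t)", OF ex])
  have t_pos: "t > 0" using t d by (cases t) auto
  have "\<not> \<not> P (d + int (t - 1))"
    unfolding t_def by (rule not_less_Least) (use t_pos t_def in simp)
  then have t_prev: "P (d + int t - 1)" using t_pos by (simp add: of_nat_diff algebra_simps)
  show ?thesis
  \<comment> \<open>With \<open>i = n\<close> and \<open>j = m\<close>, periodicity reduces the last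
    two conditions to \<open>P d\<close> and the failure of \<open>P\<close> at
    \<open>d - 1\<close>.\<close>
  proof (rule closed_path_double_crossing[of s "s + int t" n m "d - s"])
    show "P (s + n + (d - s))" using d P_cong_n[of "d + n" d] by (simp add: algebra_simps)
    show "\<not> P (s + (d - s) + m - 1)" using d P_add_m[of "d - 1"] by (simp add: algebra_simps)
  qed (use t t_le t_pos t_prev n m in \<open>auto simp: algebra_simps\<close>)
qed

lemma closed_path_through_x:
  assumes l: "3 \<le> l" "l \<le> n + m"
  shows "\<exists>vs. closed_path E vs \<and> int (length vs) = l \<and> x s \<in> set vs"
proof (cases "l = n + m \<or> (\<exists>a b c. 0 \<le> a \<and> a < m \<and> 0 \<le> b \<and> b < n \<and> a + b + 2 = l \<and>
    P c \<and> \<not> P (c + a - b))")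
  case True
  then show ?thesis using hamiltonian_closed_path closed_path_single_crossing by metis
next
  case False
  then have l': "l < n + m" using l by simp
  \<comment> \<open>Single crossings with \<open>a = l - 2 - b\<close> all fail, so \<open>P\<close>
    is closed under adding \<open>a - b\<close>.\<close>
  have closed: "P (c + (l - 2 - 2 * b))"
    if "P c" "0 \<le> l - 2 - b" "l - 2 - b < m" "0 \<le> b" "b < n" for b c
  proof -
    have "P (c + (l - 2 - b) - b)" using False that by (smt (verit))
    then show ?thesis by (simp add: algebra_simps)
  qed
  \<comment> \<open>Chosen so that \<open>b\<close> and \<open>b - 1\<close> are both admissible;
    their two periods differ by 2.\<close>
  define b where "b = max 1 (l - m)"
  have "P (c + (l - 2 - 2 * b)) \<longleftrightarrow> P c" for c
    by (intro closed_shift_iff closed) (use l l' n m in \<open>auto simp: b_def\<close>)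
  moreover have closed2: "P (c + (l - 2 - 2 * (b - 1))) \<longleftrightarrow> P c" for c
    by (intro closed_shift_iff closed) (use l l' n m in \<open>auto simp: b_def\<close>)
  ultimately have "P (c + 2) \<longleftrightarrow> P c" for c
    by (smt (verit) mult.commute add.assoc)
  then have two: "P (c + 2 * int t) \<longleftrightarrow> P c" for c t
  proof (induction t)
    case (Suc t)
    then show ?case using \<open>P (c + 2 * int t + 2) \<longleftrightarrow> P (c + 2 * int t)\<close> by (simp add: algebra_simps)
  qed simp
  have even: "P (c + e) \<longleftrightarrow> P c" if "even e" for c e
  proof (cases "e \<ge> 0")
    case True
    then show ?thesis using two[of c "nat (e div 2)"] that by simp
  next
    case False
    then show ?thesis using two[of "c + e" "nat (- e div 2)"] that by simp
  qed
  \<comment> \<open>A predicate of period 2 that is not constant alternates. Hence all its periods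
    are even, which yields the parity of \<open>n\<close>, \<open>m\<close> and \<open>l\<close>
    below.\<close>
  have odd: "P (c + e) \<longleftrightarrow> \<not> P c" if "odd e" for c e
  proof -
    obtain g where g: "P g" "\<not> P (g + 1)" using not_closed_succ by blast
    show ?thesis
    proof (cases "even (c - g)")
      case True
      then show ?thesis using even[of "c - g" g] even[of "c + e - (g + 1)" "g + 1"] g that by simp
    next
      case False
      then show ?thesis using even[of "c + e - g" g] even[of "c - (g + 1)" "g + 1"] g that by simp
    qed
  qed
  have "even n" using odd[of n] P_cong_n[of "c + n" c for c] by auto
  have "even m" using odd[of m] P_add_m by blast
  have "even l" using odd[of "l - 2 - 2 * (b - 1)"] closed2 by fastforce
  obtain c where c: "P c" using P_ex by blast
  \<comment> \<open>An even number of vertices of \<open>x\<close> is needed, leaving between 2 and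
    \<open>m\<close> vertices for \<open>y\<close>. The lower bound \<open>l - m\<close> is even and
    at most \<open>n\<close>.\<close>
  define i where "i = max 2 (l - m)"
  have i: "even i" "2 \<le> i" "i \<le> n" "2 \<le> l - i" "l - i \<le> m"
    using l l' n m \<open>even l\<close> \<open>even m\<close> unfolding i_def max_def by (auto; presburger)+
  have "\<exists>vs. closed_path E vs \<and> int (length vs) = i + (l - i) \<and> x s \<in> set vs"
  proof (rule closed_path_double_crossing[of s "s + 1" i "l - i" "c - s"])
    show "P (s + i + (c - s))" using c even[of i c] i by (simp add: algebra_simps)
    show "\<not> P (s + (c - s) + (l - i) - 1)"
      using c odd[of "l - i - 1" c] i \<open>even l\<close> by (simp add: algebra_simps)
    show "\<not> P (s + 1 + (c - s))" using c odd[of 1 c] by (simp add: algebra_simps)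
  qed (use c i in auto)
  then show ?thesis by simp
qed

end

section \<open>Absence of good cycles, reduction to two summands, and conclusion\<close>

theorem theorem3:
  fixes k :: nat
    and Ds :: "nat \<Rightarrow> 'a pair_pre_digraph"
    and C :: "nat \<Rightarrow> ('a \<times> 'a) awalk"
    and D :: "'a pair_pre_digraph"
  assumes "k \<ge> 2"
    and "\<And>i. i \<in> {1..k} \<Longrightarrow> pair_digraph (Ds i)"
    and "disjoint_family_on (\<lambda>i. pverts (Ds i)) {1..k}"
    and "\<And>i. i \<in> {1..k} \<Longrightarrow> hamiltonian_cycle (Ds i) (C i)"
    and "D \<in> generalized_sum {1..k} Ds"
    and "strongly_connected (with_proj D)"
    and "\<not> (\<exists>v0 v1 v2 v3. good_cycle {1..k} Ds D v0 v1 v2 v3)"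
  shows "vertex_pancyclic D"
proof -
  let ?I = "{1..k}"
  let ?E = "parcs D"
  have D: "pair_digraph D" and V: "pverts D = (\<Union>i\<in>?I. pverts (Ds i))"
    and induced: "\<And>i. i \<in> ?I \<Longrightarrow> induced_subgraph (with_proj (Ds i)) (with_proj D)"
    and one_arc: "\<And>i j u v. i \<in> ?I \<Longrightarrow> j \<in> ?I \<Longrightarrow> i \<noteq> j \<Longrightarrow> u \<in> pverts (Ds i) \<Longrightarrow>
      v \<in> pverts (Ds j) \<Longrightarrow> (u, v) \<in> ?E \<longleftrightarrow> (v, u) \<notin> ?E"
    using assms(5) unfolding generalized_sum_def by blast+
  interpret D: pair_digraph D by fact
  have "\<forall>i\<in>?I. \<exists>x n. cyclic_parametrization (Ds i) x n"
    using hamiltonian_cycle_imp_parametrization assms(2,4) by blast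
  from bchoice[OF this] obtain x
    where "\<forall>i\<in>?I. \<exists>n. cyclic_parametrization (Ds i) (x i) n" ..
  from bchoice[OF this] obtain n
    where param: "\<forall>i\<in>?I. cyclic_parametrization (Ds i) (x i) (n i)" ..
  have n_ge: "n i \<ge> 2" and x_eq: "x i s = x i t \<longleftrightarrow> s mod n i = t mod n i"
    and x_range: "range (x i) = pverts (Ds i)" and n_card: "n i = int (card (pverts (Ds i)))"
    and x_arc: "(x i s, x i (s + 1)) \<in> ?E" if "i \<in> ?I" for i s t
    using bspec[OF param that] induced[OF that]
    by (auto simp: cyclic_parametrization_def induced_subgraph_def subgraph_def)
  have x_mem: "x i s \<in> pverts (Ds i)" if "i \<in> ?I" for i s
    using x_range[OF that] by blast
  have x_neq: "x i s \<noteq> x j r" if "i \<in> ?I" "j \<in> ?I" "i \<noteq> j" for i j s r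
    using disjoint_family_onD[OF assms(3) that] x_mem[OF that(1), of s] x_mem[OF that(2), of r]
    by auto
  have x_succ_neq: "x i s \<noteq> x i (s + 1)" if "i \<in> ?I" for i s
    using D.no_loops'[OF x_arc[OF that]] .
  have x_one_arc: "(x i s, x j r) \<in> ?E \<longleftrightarrow> (x j r, x i s) \<notin> ?E"
    if "i \<in> ?I" "j \<in> ?I" "i \<noteq> j" for i j s r
    using one_arc[OF that x_mem x_mem] that by blast
  have exterior: "(x i s, x j r) \<in> exterior_arcs ?I Ds D"
    if "i \<in> ?I" "j \<in> ?I" "i \<noteq> j" "(x i s, x j r) \<in> ?E" for i j s r
    using that x_mem[OF that(1), of s] x_mem[OF that(2), of r]
    unfolding exterior_arcs_def by blast
  \<comment> \<open>The first and last of the four arcs are exterior and disjoint, which already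
    makes the anti-directed cycle good. Hence \<open>l\<close> may equal \<open>j\<close> or be a
    third summand.\<close>
  have no_good: False
    if "i \<in> ?I" "j \<in> ?I" "l \<in> ?I" "i \<noteq> j" "i \<noteq> l"
      "(x i s, x j r) \<in> ?E" "(x i s, x i t) \<in> ?E" "(x l q, x j r) \<in> ?E" "(x l q, x i t) \<in> ?E"
    for i j l s r t q
  proof -
    have "(x i s, x j r) \<in> exterior_arcs ?I Ds D" "(x l q, x i t) \<in> exterior_arcs ?I Ds D"
      using exterior that by simp_all
    moreover have "antidirected_4_cycle D (x i s) (x j r) (x l q) (x i t)"
      unfolding antidirected_4_cycle_def
      using that x_neq[of i j s r] x_neq[of i j t r] x_neq[of i l s q] x_neq[of i l t q]
        D.no_loops'[OF that(7)] D.no_loops'[OF that(8)] by auto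
    ultimately show False using assms(7) unfolding good_cycle_def by blast
  qed
  \<comment> \<open>The reverse arc would complete a good cycle with \<open>x i s\<close>,
    \<open>x i (s + 1)\<close> and \<open>x j r\<close>. For \<open>l = j\<close> and
    \<open>q = r - 1\<close> this gives \<open>shift\<close>; for a third summand it moves the head
    of an arc into another summand.\<close>
  have pull: "(x i (s + 1), x l q) \<in> ?E"
    if "i \<in> ?I" "j \<in> ?I" "l \<in> ?I" "i \<noteq> j" "i \<noteq> l"
      "(x i s, x j r) \<in> ?E" "(x l q, x j r) \<in> ?E" for i j l s r q
    using no_good[OF that(1-6) x_arc[OF that(1)] that(7)] x_one_arc[of i l "s + 1" q] that by blast
  \<comment> \<open>If all arcs go from summand \<open>i\<close> to summand \<open>j\<close>, any
    two vertices of each form a good cycle.\<close>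
  have one_way_absurd: "\<exists>s r. (x i s, x j r) \<notin> ?E" if ij: "i \<in> ?I" "j \<in> ?I" "i \<noteq> j" for i j
  proof (rule ccontr)
    assume "\<not> ?thesis"
    then have all: "(x i s, x j r) \<in> ?E" for s r by blast
    have "x i 0 \<noteq> x i 1" "x j 0 \<noteq> x j 1"
      using x_succ_neq[of i 0] x_succ_neq[of j 0] ij by simp_all
    then have "antidirected_4_cycle D (x i 0) (x j 0) (x i 1) (x j 1)"
      unfolding antidirected_4_cycle_def using all x_neq[OF ij] by (simp add: eq_commute)
    moreover have "(x i s, x j r) \<in> exterior_arcs ?I Ds D" for s r
      using exterior[OF ij] all by simp
    ultimately show False using assms(7) unfolding good_cycle_def by blast
  qed
  have linked: "linked_cycles ?E (x i) (x j) (n i) (n j)"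
    if ij: "i \<in> ?I" "j \<in> ?I" "i \<noteq> j" for i j
  proof unfold_locales
    show "(x i (s + 1), x j (r - 1)) \<in> ?E" if "(x i s, x j r) \<in> ?E" for s r
      using pull[OF ij(1,2,2,3,3) that] x_arc[OF ij(2), of "r - 1"] by simp
    show "\<exists>s r. (x i s, x j r) \<in> ?E" "\<exists>s r. (x i s, x j r) \<notin> ?E"
      using one_way_absurd[OF ij] one_way_absurd[OF ij(2,1)] x_one_arc[OF ij] ij(3) by blast+
  qed (rule n_ge x_eq x_neq x_arc x_one_arc, (rule ij)+)+
  have no_three: False if I: "a \<in> ?I" "b \<in> ?I" "c \<in> ?I" "a \<noteq> b" "a \<noteq> c" "b \<noteq> c" for a b c
  proof -
    interpret bc: linked_cycles ?E "x b" "x c" "n b" "n c" using linked I by simp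
    interpret ab: linked_cycles ?E "x a" "x b" "n a" "n b" using linked I by simp
    obtain e where "bc.P e" "\<not> bc.P (e + 1)" using bc.not_closed_succ by blast
    then have to_c: "(x b e, x c 0) \<in> ?E" and from_c: "(x c 0, x b (e + 1)) \<in> ?E"
      by (simp_all add: bc.E_iff_P bc.E_back_iff_P)
    have "ab.P (d + 1)" if "ab.P d" for d
    proof -
      \<comment> \<open>Starting from index sum \<open>d\<close>, two pulls through
        \<open>x c 0\<close> raise the index on \<open>x a\<close> by two and lower the one on
        \<open>x b\<close> by one, ending at index sum \<open>d + 1\<close>.\<close>
      have "(x a (d - e - 1), x b (e + 1)) \<in> ?E" using that by (simp add: ab.E_iff_P)
      then have "(x a (d - e), x c 0) \<in> ?E"
        using pull[OF I(1,2,3,4,5) _ from_c, of "d - e - 1"] by simp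
      then have "(x a (d - e + 1), x b e) \<in> ?E"
        using pull[OF I(1,3,2,5,4) _ to_c, of "d - e"] by simp
      then show ?thesis by (simp add: ab.E_iff_P algebra_simps)
    qed
    then show False using ab.not_closed_succ by blast
  qed
  have "k = 2"
    using no_three[of 1 2 3] assms(1) by (cases "k = 2") auto
  then have "?I = {1, 2}" by auto
  moreover have "(1::nat) \<noteq> 2" by simp
  ultimately obtain a b where I: "?I = {a, b}" and ab: "a \<in> ?I" "b \<in> ?I" "a \<noteq> b" by blast
  interpret linked_cycles ?E "x a" "x b" "n a" "n b" using linked ab .
  interpret flipped: linked_cycles ?E "x b" "x a" "n b" "n a" by (rule flip)
  have V_ab: "pverts D = pverts (Ds a) \<union> pverts (Ds b)"
    unfolding V I by simp
  have "card (pverts D) = card (pverts (Ds a)) + card (pverts (Ds b))"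
    unfolding V_ab
  proof (rule card_Un_disjoint)
    show "finite (pverts (Ds a))" "finite (pverts (Ds b))"
      using D.finite_verts V_ab by simp_all
    show "pverts (Ds a) \<inter> pverts (Ds b) = {}"
      using disjoint_family_onD[OF assms(3) ab] .
  qed
  then have card: "int (card (pverts D)) = n a + n b"
    using n_card[OF ab(1)] n_card[OF ab(2)] by simp
  show ?thesis unfolding vertex_pancyclic_def
  proof (intro conjI ballI)
    show "3 \<le> card (pverts D)" using card n_ge[OF ab(1)] n_ge[OF ab(2)] by linarith
    fix v l assume v: "v \<in> pverts D" and l: "l \<in> {3..card (pverts D)}"
    then have l': "3 \<le> int l" "int l \<le> n a + n b" "int l \<le> n b + n a" using card by auto
    obtain s where "v = x a s \<or> v = x b s"
      using v x_range[OF ab(1)] x_range[OF ab(2)] unfolding V_ab by blast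
    then obtain vs where vs: "closed_path ?E vs" "int (length vs) = int l" "v \<in> set vs"
      using closed_path_through_x[OF l'(1,2)] flipped.closed_path_through_x[OF l'(1,3)] by metis
    then show "\<exists>p. pre_digraph.cycle (with_proj D) p \<and> length p = l \<and> v \<in> fst ` set p"
      using closed_path_imp_cycle[OF D vs(1)] by (metis of_nat_eq_iff)
  qed
qed

end
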